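(* Let $\phi\colon\operatorname{Sym}^{++}(n)\to\mathbb R$ be smooth. Its Riemannian (natural) gradient $\operatorname{grad}\phi$ with respect to the Wasserstein Riemannian metric is $$\operatorname{grad}\phi(\Sigma)=\mathcal L_\Sigma^{-1}[\nabla\phi(\Sigma)]=\nabla\phi(\Sigma)\,\Sigma+\Sigma\,\nabla\phi(\Sigma),\qquad\Sigma\in\operatorname{Sym}^{++}(n),$$ and conversely $\mathcal L_\Sigma[\operatorname{grad}\phi(\Sigma)]=\nabla\phi(\Sigma)$.
   Context: $\operatorname{Sym}(n)$ is the space of real symmetric $n\times n$ matrices with inner product $\langle A,B\rangle_2=\frac12\operatorname{Tr}(AB)$; $\operatorname{Sym}^{++}(n)$ is the open cone of positive-definite ones. For $\Sigma\in\operatorname{Sym}^{++}(n)$ and $V\in\operatorname{Sym}(n)$, $\mathcal L_\Sigma[V]$ is the unique $X\in\operatorname{Sym}(n)$ with $X\Sigma+\Sigma X=V$. The Wasserstein Riemannian metric is $W_\Sigma(U,V)=\operatorname{Tr}(\mathcal L_\Sigma[U]\Sigma\mathcal L_\Sigma[V])$. $\nabla\phi(\Sigma)\in\operatorname{Sym}(n)$ denotes the gradient with respect to $\langle\cdot,\cdot\rangle_2$, i.e. $d_V\phi(\Sigma)=\langle\nabla\phi(\Sigma),V\rangle_2$ for all $V\in\operatorname{Sym}(n)$; $\operatorname{grad}\phi(\Sigma)\in\operatorname{Sym}(n)$ is the gradient with respect to the Riemannian metric, i.e. $d_V\phi(\Sigma)=W_\Sigma(\operatorname{grad}\phi(\Sigma),V)$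 for all $V\in\operatorname{Sym}(n)$. *)

theory Defs
  imports "HOL-Analysis.Analysis"
begin

definition Sym :: "(real^'n^'n) set" where
  "Sym = {A. transpose A = A}"

definition SPD :: "(real^'n^'n) set" where
  "SPD = {A \<in> Sym. \<forall>x. x \<noteq> 0 \<longrightarrow> x \<bullet> (A *v x) > 0}"

definition inner2 :: "real^'n^'n \<Rightarrow> real^'n^'n \<Rightarrow> real" where
  "inner2 A B = 1 / 2 * trace (A ** B)"

definition lyap :: "real^'n^'n \<Rightarrow> real^'n^'n \<Rightarrow> real^'n^'n" where
  "lyap S V = (THE X. X \<in> Sym \<and> X ** S + S ** X = V)"

definition wass_metric :: "real^'n^'n \<Rightarrow> real^'n^'n \<Rightarrow> real^'n^'n \<Rightarrow> real" where
  "wass_metric S U V = trace (lyap S U ** S ** lyap S V)"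

text \<open>Functions on the open cone are total functions on all matrices of which only the values on
  \<^const>\<open>SPD\<close> matter. Since \<^const>\<open>SPD\<close> is open in \<^const>\<open>Sym\<close>, but not in the space of all matrices,
  only the directional derivatives in symmetric directions are meaningful.\<close>

definition dir_deriv :: "(real^'n^'n \<Rightarrow> real) \<Rightarrow> real^'n^'n \<Rightarrow> real^'n^'n \<Rightarrow> real" where
  "dir_deriv f S V = deriv (\<lambda>t. f (S + t *\<^sub>R V)) 0"

fun Ck_on_SPD :: "nat \<Rightarrow> (real^'n^'n \<Rightarrow> real) \<Rightarrow> bool" where
  "Ck_on_SPD 0 f \<longleftrightarrow> continuous_on SPD f"
| "Ck_on_SPD (Suc k) f \<longleftrightarrow>
     f differentiable_on SPD \<and> (\<forall>V\<in>Sym. Ck_on_SPD k (\<lambda>S. dir_deriv f S V))"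

definition smooth_on_SPD :: "(real^'n^'n \<Rightarrow> real) \<Rightarrow> bool" where
  "smooth_on_SPD f \<longleftrightarrow> (\<forall>k. Ck_on_SPD k f)"

definition eucl_grad :: "(real^'n^'n \<Rightarrow> real) \<Rightarrow> real^'n^'n \<Rightarrow> real^'n^'n" where
  "eucl_grad f S = (THE G. G \<in> Sym \<and> (\<forall>V\<in>Sym. dir_deriv f S V = inner2 G V))"

definition wass_grad :: "(real^'n^'n \<Rightarrow> real) \<Rightarrow> real^'n^'n \<Rightarrow> real^'n^'n" where
  "wass_grad f S = (THE G. G \<in> Sym \<and> (\<forall>V\<in>Sym. dir_deriv f S V = wass_metric S G V))"

text \<open>The definite descriptions above are well defined.\<close>

lemma trace_mult_eq_inner: "trace (transpose A ** B) = A \<bullet> (B::real^'n^'n)"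
  unfolding trace_def matrix_matrix_mult_def transpose_def inner_vec_def
  by (simp, rule sum.swap)

lemma trace_transpose: "trace (transpose A) = trace (A::real^'n^'n)"
  by (simp add: trace_def transpose_def)

lemma transpose_add: "transpose (A + B) = transpose A + transpose (B::real^'n^'n)"
  by (simp add: transpose_def vec_eq_iff)

lemma SPD_trace_pos:
  fixes X S :: "real^'n^'n"
  assumes S: "S \<in> SPD" and X: "X \<noteq> 0"
  shows "trace (transpose X ** (S ** X)) > 0"
proof -
  have e: "trace (transpose X ** (S ** X)) = (\<Sum>j\<in>UNIV. column j X \<bullet> (S *v column j X))"
    unfolding trace_def matrix_matrix_mult_def transpose_def inner_vec_def column_def
      matrix_vector_mult_def by simp
  have nn: "column j X \<bullet> (S *v column j X) \<ge> 0" for j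
    using S by (cases "column j X = 0") (auto simp: SPD_def less_imp_le)
  from X obtain i j where "X $ i $ j \<noteq> 0" by (auto simp: vec_eq_iff)
  then have "column j X \<noteq> 0" by (auto simp: column_def vec_eq_iff)
  then have "column j X \<bullet> (S *v column j X) > 0" using S by (auto simp: SPD_def)
  then show ?thesis unfolding e by (intro sum_pos2[of _ j]) (auto simp: nn)
qed

lemma lyap_zero:
  fixes X S :: "real^'n^'n"
  assumes S: "S \<in> SPD" and eq: "X ** S + S ** X = 0"
  shows "X = 0"
proof (rule ccontr)
  assume X: "X \<noteq> 0"
  then have Xt: "transpose X \<noteq> 0"
    by (auto simp: transpose_def vec_eq_iff)
  have tS: "transpose S = S" using S by (simp add: SPD_def Sym_def)
  have "0 = trace (transpose X ** (X ** S + S ** X))" by (simp add: eq trace_def)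
  also have "\<dots> = trace (transpose X ** (X ** S)) + trace (transpose X ** (S ** X))"
    by (simp add: matrix_add_ldistrib trace_add)
  also have "trace (transpose X ** (X ** S)) = trace ((X ** S) ** transpose X)"
    by (rule trace_mul_sym)
  also have "\<dots> = trace (transpose (transpose X) ** (S ** transpose X))"
    by (simp add: matrix_mul_assoc)
  finally show False using SPD_trace_pos[OF S X] SPD_trace_pos[OF S Xt] by linarith
qed

lemma lyap_ex1:
  fixes S V :: "real^'n^'n"
  assumes S: "S \<in> SPD" and V: "V \<in> Sym"
  shows "\<exists>!X. X \<in> Sym \<and> X ** S + S ** X = V"
proof -
  let ?F = "\<lambda>X::real^'n^'n. X ** S + S ** X"
  have tS: "transpose S = S" using S by (simp add: SPD_def Sym_def)
  have lin: "linear ?F"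
  proof (rule linearI)
    fix X Y show "?F (X + Y) = ?F X + ?F Y"
      by (simp add: vec_eq_iff matrix_matrix_mult_def sum.distrib distrib_left distrib_right)
  next
    fix c X show "?F (c *\<^sub>R X) = c *\<^sub>R ?F X"
      by (simp add: vec_eq_iff matrix_matrix_mult_def sum_distrib_left distrib_left
          mult.assoc mult.left_commute)
  qed
  have inj: "inj ?F"
    unfolding linear_injective_0[OF lin] using lyap_zero[OF S] by blast
  then have "surj ?F" using linear_injective_imp_surjective[OF lin] by simp
  then obtain X where "V = ?F X" by (rule surjE)
  then have X: "?F X = V" by (rule sym)
  have "?F (transpose X) = transpose (?F X)"
    by (simp add: transpose_add matrix_transpose_mul tS add.commute)
  also have "\<dots> = ?F X" using V unfolding X by (simp add: Sym_def)
  finally have "transpose X = X" by (rule injD[OF inj])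
  show ?thesis
  proof (rule ex1I[of _ X])
    show "X \<in> Sym \<and> ?F X = V" using \<open>transpose X = X\<close> X by (simp add: Sym_def)
  next
    fix Y assume "Y \<in> Sym \<and> ?F Y = V"
    then have "?F Y = ?F X" using X by simp
    then show "Y = X" by (rule injD[OF inj])
  qed
qed

lemma SPD_line_eventually:
  fixes S V :: "real^'n^'n"
  assumes S: "S \<in> SPD" and V: "V \<in> Sym"
  shows "\<forall>\<^sub>F t in nhds 0. S + t *\<^sub>R V \<in> SPD"
proof -
  let ?q = "\<lambda>(A::real^'n^'n) x. x \<bullet> (A *v x)"
  let ?K = "sphere (0::real^'n) 1"
  have c: "continuous_on ?K (?q A)" for A
    by (intro continuous_intros linear_continuous_on_compose[of _ id, simplified]
        matrix_vector_mul_linear)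
  have K: "compact ?K" "?K \<noteq> {}" by auto
  obtain x0 where x0: "x0 \<in> ?K" "\<And>x. x \<in> ?K \<Longrightarrow> ?q S x0 \<le> ?q S x"
    using continuous_attains_inf[OF K c] by blast
  have "x0 \<noteq> 0" using x0(1) by auto
  then have m: "?q S x0 > 0" using S by (auto simp: SPD_def)
  have "bounded (?q V ` ?K)" by (intro compact_imp_bounded compact_continuous_image c K)
  then obtain B where B: "B > 0" "\<And>x. x \<in> ?K \<Longrightarrow> \<bar>?q V x\<bar> \<le> B"
    by (auto simp: bounded_pos)
  have main: "S + t *\<^sub>R V \<in> SPD" if t: "\<bar>t\<bar> < ?q S x0 / B" for t
  proof -
    have "?q (S + t *\<^sub>R V) x > 0" if x: "x \<noteq> 0" for x
    proof -
      define y where "y = x /\<^sub>R norm x"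
      have y: "y \<in> ?K" using x by (simp add: y_def)
      have "\<bar>t * ?q V y\<bar> \<le> \<bar>t\<bar> * B" using B(2)[OF y] by (simp add: abs_mult mult_left_mono)
      also have "\<dots> < ?q S x0" using t B(1) by (simp add: field_simps)
      also have "\<dots> \<le> ?q S y" by (rule x0(2)[OF y])
      finally have p: "?q (S + t *\<^sub>R V) y > 0"
        by (simp add: matrix_vector_mult_add_rdistrib inner_add_right
            scaleR_matrix_vector_assoc[symmetric])
      have "x = norm x *\<^sub>R y" using x by (simp add: y_def)
      then have "?q (S + t *\<^sub>R V) x = norm x * (norm x * ?q (S + t *\<^sub>R V) y)"
        by (metis inner_scaleR_left inner_scaleR_right matrix_vector_mult_scaleR)
      then show ?thesis using p x by simp
    qed
    moreover have "S + t *\<^sub>R V \<in> Sym"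
      using S V by (auto simp: SPD_def Sym_def transpose_def vec_eq_iff)
    ultimately show ?thesis by (auto simp: SPD_def)
  qed
  show ?thesis unfolding eventually_nhds_metric
    by (rule exI[of _ "?q S x0 / B"]) (use main m B in \<open>auto simp: dist_real_def\<close>)
qed

lemma eucl_grad_ex1:
  fixes S :: "real^'n^'n"
  assumes f: "smooth_on_SPD f" and S: "S \<in> SPD"
  shows "\<exists>!G. G \<in> Sym \<and> (\<forall>V\<in>Sym. dir_deriv f S V = inner2 G V)"
proof -
  have "Ck_on_SPD (Suc 0) f" using f unfolding smooth_on_SPD_def by blast
  then have "f differentiable (at S within SPD)" using S by (auto simp: differentiable_on_def)
  then obtain D where D: "(f has_derivative D) (at S within SPD)"
    by (auto simp: differentiable_def)
  have linD: "linear D" using D has_derivative_linear by blast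
  have dd: "dir_deriv f S V = D V" if V: "V \<in> Sym" for V
  proof -
    obtain U where U: "open U" "0 \<in> U" "\<And>t. t \<in> U \<Longrightarrow> S + t *\<^sub>R V \<in> SPD"
      using SPD_line_eventually[OF S V] unfolding eventually_nhds by blast
    have "((\<lambda>t. S + t *\<^sub>R V) has_derivative (\<lambda>t. t *\<^sub>R V)) (at 0 within U)"
      by (auto intro!: derivative_eq_intros)
    moreover have "(f has_derivative D) (at (S + 0 *\<^sub>R V) within (\<lambda>t. S + t *\<^sub>R V) ` U)"
    proof -
      have "(\<lambda>t. S + t *\<^sub>R V) ` U \<subseteq> SPD" using U(3) by blast
      from has_derivative_subset[OF D this] show ?thesis by simp
    qed
    ultimately have "((\<lambda>t. f (S + t *\<^sub>R V)) has_derivative (\<lambda>t. D (t *\<^sub>R V))) (at 0 within U)"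
      by (rule has_derivative_in_compose)
    then have "((\<lambda>t. f (S + t *\<^sub>R V)) has_derivative (\<lambda>t. D (t *\<^sub>R V))) (at 0)"
      by (simp only: at_within_open[OF U(2,1)])
    moreover have "(\<lambda>t. D (t *\<^sub>R V)) = (*) (D V)"
      by (simp add: linear_cmul[OF linD] fun_eq_iff mult.commute[of "D V"])
    ultimately have "((\<lambda>t. f (S + t *\<^sub>R V)) has_field_derivative D V) (at 0)"
      by (simp only: has_field_derivative_def)
    then show ?thesis unfolding dir_deriv_def by (rule DERIV_imp_deriv)
  qed
  define g where "g = adjoint D 1"
  have g: "D V = g \<bullet> V" for V
    using adjoint_works[OF linD, of V 1] by (simp add: g_def inner_commute)
  have i2: "inner2 G V = 1 / 2 * (G \<bullet> V)" if "G \<in> Sym" for G V :: "real^'n^'n"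
    using that trace_mult_eq_inner[of G V] by (simp add: Sym_def inner2_def)
  have tr: "transpose g \<bullet> V = g \<bullet> V" if "V \<in> Sym" for V
  proof -
    have "transpose g \<bullet> V = trace (g ** V)"
      using trace_mult_eq_inner[of "transpose g" V] by simp
    also have "\<dots> = trace (transpose (g ** V))" by (simp add: trace_transpose)
    also have "transpose (g ** V) = V ** transpose g"
      using that by (simp add: matrix_transpose_mul Sym_def)
    also have "trace (V ** transpose g) = trace (transpose g ** V)"
      by (rule trace_mul_sym)
    finally show ?thesis by (simp add: trace_mult_eq_inner)
  qed
  have s: "g + transpose g \<in> Sym" by (simp add: Sym_def transpose_add add.commute)
  have ex: "\<forall>V\<in>Sym. dir_deriv f S V = inner2 (g + transpose g) V"
    by (simp add: dd g i2[OF s] inner_add_left tr)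
  show ?thesis
  proof (rule ex1I[of _ "g + transpose g"])
    show "g + transpose g \<in> Sym \<and> (\<forall>V\<in>Sym. dir_deriv f S V = inner2 (g + transpose g) V)"
      using s ex by blast
  next
    fix H assume H: "H \<in> Sym \<and> (\<forall>V\<in>Sym. dir_deriv f S V = inner2 H V)"
    let ?E = "H - (g + transpose g)"
    have "?E \<in> Sym" using H s by (auto simp: Sym_def transpose_def vec_eq_iff)
    then have "inner2 H ?E = inner2 (g + transpose g) ?E" using H ex by metis
    then have "?E \<bullet> ?E = 0" using i2 H s by (simp add: inner_diff_left)
    then show "H = g + transpose g" by simp
  qed
qed

lemma wass_grad_ex1:
  fixes S :: "real^'n^'n"
  assumes f: "smooth_on_SPD f" and S: "S \<in> SPD"
  shows "\<exists>!G. G \<in> Sym \<and> (\<forall>V\<in>Sym. dir_deriv f S V = wass_metric S G V)"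
proof -
  let ?F = "\<lambda>X::real^'n^'n. X ** S + S ** X"
  have tS: "transpose S = S" using S by (simp add: SPD_def Sym_def)
  have L: "lyap S V \<in> Sym \<and> ?F (lyap S V) = V" if "V \<in> Sym" for V
    unfolding lyap_def by (rule theI'[OF lyap_ex1[OF S that]])
  have W: "wass_metric S U V = inner2 (lyap S U) V" if U: "U \<in> Sym" and V: "V \<in> Sym" for U V
  proof -
    let ?X = "lyap S U" and ?Y = "lyap S V"
    have tX: "transpose ?X = ?X" and tY: "transpose ?Y = ?Y"
      using L[OF U] L[OF V] by (auto simp: Sym_def)
    have "trace (?X ** (?Y ** S)) = trace (transpose (?X ** (?Y ** S)))"
      by (simp add: trace_transpose)
    also have "transpose (?X ** (?Y ** S)) = (S ** ?Y) ** ?X"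
      by (simp add: matrix_transpose_mul tX tY tS)
    also have "trace \<dots> = trace (?X ** (S ** ?Y))" by (rule trace_mul_sym)
    finally have "trace (?X ** ?F ?Y) = 2 * trace (?X ** S ** ?Y)"
      by (simp add: matrix_add_ldistrib trace_add matrix_mul_assoc)
    then show ?thesis using L[OF V] by (simp add: wass_metric_def inner2_def)
  qed
  obtain g where g: "g \<in> Sym" "\<forall>V\<in>Sym. dir_deriv f S V = inner2 g V"
    and gu: "\<And>h. h \<in> Sym \<Longrightarrow> \<forall>V\<in>Sym. dir_deriv f S V = inner2 h V \<Longrightarrow> h = g"
    using eucl_grad_ex1[OF f S] by (elim ex1E) blast
  have FS: "?F g \<in> Sym"
    using g(1) by (simp add: Sym_def transpose_add matrix_transpose_mul tS add.commute)
  have Lg: "lyap S (?F g) = g"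
    using lyap_ex1[OF S FS] L[OF FS] g(1) by (elim ex1E) metis
  show ?thesis
  proof (rule ex1I[of _ "?F g"])
    show "?F g \<in> Sym \<and> (\<forall>V\<in>Sym. dir_deriv f S V = wass_metric S (?F g) V)"
      using FS W[OF FS] Lg g(2) by simp
  next
    fix H assume H: "H \<in> Sym \<and> (\<forall>V\<in>Sym. dir_deriv f S V = wass_metric S H V)"
    then have "lyap S H = g" using L[of H] W[of H] by (intro gu) auto
    then show "H = ?F g" using L[of H] H by metis
  qed
qed

end

theory Submission
  imports Defs
begin

text \<open>
  The Wasserstein metric differs from the Euclidean inner product only by the Lyapunov operator in
  one slot: for symmetric \<open>U\<close> and \<open>V\<close>, \<open>W\<^sub>\<Sigma>(U, V) = \<langle>\<L>\<^sub>\<Sigma>[U], V\<rangle>\<^sub>2\<close>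
  (lemma \<open>wass_metric_eq_inner2\<close>). Hence if \<open>G\<close> represents the differential of \<open>\<phi>\<close> with respect
  to \<open>W\<^sub>\<Sigma>\<close>, then \<open>\<L>\<^sub>\<Sigma>[G]\<close> represents the same differential with respect to
  \<open>\<langle>\<cdot>, \<cdot>\<rangle>\<^sub>2\<close>, and by uniqueness of the representing matrix it is the Euclidean gradient. This gives
  \<open>\<L>\<^sub>\<Sigma>[grad \<phi>(\<Sigma>)] = \<nabla>\<phi>(\<Sigma>)\<close>. The two formulas for \<open>grad \<phi>\<close> only undo \<open>\<L>\<^sub>\<Sigma>\<close>, whose inverse
  is \<open>X \<mapsto> X \<Sigma> + \<Sigma> X\<close> by its very definition.
\<close>

lemma
  fixes S V :: "real^'n^'n"
  assumes "S \<in> SPD" and "V \<in> Sym"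
  shows lyap_in_Sym: "lyap S V \<in> Sym"
    and lyap_equation: "lyap S V ** S + S ** lyap S V = V"
  using theI'[OF lyap_ex1[OF assms], folded lyap_def] by blast+

lemma inj_on_lyap:
  fixes S :: "real^'n^'n"
  assumes "S \<in> SPD"
  shows "inj_on (lyap S) Sym"
  by (rule inj_onI) (metis lyap_equation[OF assms])

text \<open>
  With \<open>X = \<L>\<^sub>S[U]\<close> and \<open>Y = \<L>\<^sub>S[V]\<close> one has \<open>Tr(X V) = Tr(X Y S) + Tr(X S Y)\<close>. The two summands
  agree, because the trace is invariant under transposition and under cyclic permutation and
  because \<open>X\<close>, \<open>Y\<close>, \<open>S\<close> are symmetric; this is where the factor \<open>1/2\<close> of the inner product is used up.
\<close>

lemma wass_metric_eq_inner2:
  fixes S U V :: "real^'n^'n"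
  assumes S: "S \<in> SPD" and U: "U \<in> Sym" and V: "V \<in> Sym"
  shows "wass_metric S U V = inner2 (lyap S U) V"
proof -
  let ?X = "lyap S U" and ?Y = "lyap S V"
  have sym: "transpose S = S" "transpose ?X = ?X" "transpose ?Y = ?Y"
    using S lyap_in_Sym[OF S U] lyap_in_Sym[OF S V] by (simp_all add: SPD_def Sym_def)
  have "trace (?X ** (?Y ** S)) = trace (transpose (?X ** (?Y ** S)))"
    by (simp only: trace_transpose)
  also have "\<dots> = trace ((S ** ?Y) ** ?X)"
    by (simp add: matrix_transpose_mul sym)
  also have "\<dots> = trace (?X ** (S ** ?Y))"
    by (rule trace_mul_sym)
  finally have "trace (?X ** (?Y ** S + S ** ?Y)) = 2 * trace (?X ** S ** ?Y)"
    by (simp add: matrix_add_ldistrib trace_add matrix_mul_assoc)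
  then show ?thesis
    by (simp add: lyap_equation[OF S V] wass_metric_def inner2_def)
qed

theorem mainTheorem7:
  fixes \<phi> :: "real^'n^'n \<Rightarrow> real"
  assumes "smooth_on_SPD \<phi>"
  shows "\<forall>\<Sigma>\<in>SPD.
    wass_grad \<phi> \<Sigma> = inv_into Sym (lyap \<Sigma>) (eucl_grad \<phi> \<Sigma>) \<and>
    wass_grad \<phi> \<Sigma> = eucl_grad \<phi> \<Sigma> ** \<Sigma> + \<Sigma> ** eucl_grad \<phi> \<Sigma> \<and>
    lyap \<Sigma> (wass_grad \<phi> \<Sigma>) = eucl_grad \<phi> \<Sigma>"
proof
  fix \<Sigma> :: "real^'n^'n"
  assume S: "\<Sigma> \<in> SPD"
  let ?G = "wass_grad \<phi> \<Sigma>"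
  have G: "?G \<in> Sym" and dG: "\<forall>V\<in>Sym. dir_deriv \<phi> \<Sigma> V = wass_metric \<Sigma> ?G V"
    using theI'[OF wass_grad_ex1[OF assms S], folded wass_grad_def] by blast+
  have "\<forall>V\<in>Sym. dir_deriv \<phi> \<Sigma> V = inner2 (lyap \<Sigma> ?G) V"
    using dG wass_metric_eq_inner2[OF S G] by simp
  then have lyap_G: "lyap \<Sigma> ?G = eucl_grad \<phi> \<Sigma>"
    unfolding eucl_grad_def
    by (intro the1_equality[symmetric] eucl_grad_ex1 assms S conjI lyap_in_Sym[OF S G])
  have "?G = inv_into Sym (lyap \<Sigma>) (eucl_grad \<phi> \<Sigma>)"
    using inv_into_f_f[OF inj_on_lyap[OF S] G] by (simp add: lyap_G)
  moreover have "?G = eucl_grad \<phi> \<Sigma> ** \<Sigma> + \<Sigma> ** eucl_grad \<phi> \<Sigma>"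
    using lyap_equation[OF S G] by (simp add: lyap_G)
  ultimately show "?G = inv_into Sym (lyap \<Sigma>) (eucl_grad \<phi> \<Sigma>) \<and>
      ?G = eucl_grad \<phi> \<Sigma> ** \<Sigma> + \<Sigma> ** eucl_grad \<phi> \<Sigma> \<and> lyap \<Sigma> ?G = eucl_grad \<phi> \<Sigma>"
    using lyap_G by blast
qed

end
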